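(* Let $s\ge 1$ be an integer and let $\Theta=\sum_{u=1}^{\nu}\pi_u\delta(\gamma_u)$ be a finitely supported probability distribution with weights $\pi_u>0$, $\sum_{u=1}^{\nu}\pi_u=1$, and distinct support points $\gamma_u>0$. Let $\phi_j(t)$, $\phi_+(t)$ and the mixing distribution $Q=\sum_{u=1}^{\nu}\omega_u\delta(\gamma_u)$ be as defined in the context. Then for every integer $h\ge 1$, every $j\in\{1,2,\dots,h\}$ and every $t\in[0,\infty)$, $$\phi_j(t)=\phi_+(1)\,\theta_j(t,Q),$$ where $$\theta_j(t,Q)=\sum_{u=1}^{\nu}\omega_u\frac{\exp(-\gamma_u t)(\gamma_u t)^j}{\{1-\exp(-\gamma_u)\}\,j!}.$$
   Context: $\delta(\lambda)$ denotes the probability distribution degenerate at $\lambda$. There are $s$ species; the rates $\lambda_1,\dots,\lambda_s$ are a random sample from $\Theta$, and given the rates, the number $Y_i(t)$ of individuals of species $i$ sampled during $[0,t]$ is a Poisson process with rate $\lambda_i$. Let $n_j(t)=\sum_{i=1}^s I(Y_i(t)=j)$ be the number of species represented by exactly $j$ individuals, where $I(\cdot)$ is the indicator function. For $j\ge 1$, $$\phi_j(t)=E\{n_j(t)\}=s\sum_{u=1}^{\nu}\pi_u\exp(-\gamma_u t)\frac{(\gamma_u t)^j}{j!},\qquad \phi_+(t)=\sum_{j=1}^{\infty}\phi_j(t).$$ The weights of $Q=\sum_{u=1}^{\nu}\omega_u\delta(\gamma_u)$ are $$\omega_u=\frac{\pi_u\{1-\exp(-\gamma_u)\}}{\sum_{w=1}^{\nu}\pi_w\{1-\exp(-\gamma_w)\}}.$$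 *)

theory Defs
  imports "HOL-Probability.Probability"
begin

text \<open>
  The finitely supported distribution \<open>w\<^sub>1 \<delta>(g\<^sub>1) + \<dots> + w\<^sub>\<nu> \<delta>(g\<^sub>\<nu>)\<close> is the push-forward under \<open>g\<close>
  of the measure on the index set with masses \<open>w\<close>; \<open>emeasure_finite_mixture\<close> below gives the
  usual formula.
\<close>

definition finite_mixture :: "nat \<Rightarrow> (nat \<Rightarrow> real) \<Rightarrow> (nat \<Rightarrow> real) \<Rightarrow> real measure" where
  "finite_mixture \<nu> w g = distr (point_measure {1..\<nu>} (\<lambda>u. ennreal (w u))) borel g"

lemma emeasure_finite_mixture:
  assumes "A \<in> sets borel"
  shows "emeasure (finite_mixture \<nu> w g) A
    = (\<Sum>u=1..\<nu>. ennreal (w u) * emeasure (return borel (g u)) A)"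
proof -
  have "emeasure (finite_mixture \<nu> w g) A = (\<Sum>u\<in>g -` A \<inter> {1..\<nu>}. ennreal (w u))"
    unfolding finite_mixture_def using assms
    by (subst emeasure_distr) (auto simp: space_point_measure emeasure_point_measure_finite)
  also have "\<dots> = (\<Sum>u=1..\<nu>. if g u \<in> A then ennreal (w u) else 0)"
    by (rule sum.mono_neutral_cong_left) auto
  also have "\<dots> = (\<Sum>u=1..\<nu>. ennreal (w u) * emeasure (return borel (g u)) A)"
    using assms by (intro sum.cong) (auto simp: indicator_def)
  finally show ?thesis .
qed

text \<open>
  A Poisson process with rate \<open>r\<close> on the time axis \<open>[0, \<infinity>)\<close>. Counts are natural numbers; the
  truncated subtraction in the increments is a true difference almost surely, because the paths
  are nondecreasing.
\<close>

definition poisson_process :: "'a measure \<Rightarrow> real \<Rightarrow> (real \<Rightarrow> 'a \<Rightarrow> nat) \<Rightarrow> bool" where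
  "poisson_process N r Y \<longleftrightarrow>
     0 < r \<and> prob_space N \<and>
     (\<forall>t\<ge>0. Y t \<in> measurable N (count_space UNIV)) \<and>
     (AE x in N. Y 0 x = 0 \<and> mono_on {0..} (\<lambda>t. Y t x) \<and>
        (\<forall>t\<ge>0. continuous (at_right t) (\<lambda>t. real (Y t x)))) \<and>
     (\<forall>n \<tau>. 0 \<le> \<tau> 0 \<and> mono_on {..n} \<tau> \<longrightarrow>
        prob_space.indep_vars N (\<lambda>_. count_space UNIV)
          (\<lambda>k x. Y (\<tau> (Suc k)) x - Y (\<tau> k) x) {..<n}) \<and>
     (\<forall>a b. 0 \<le> a \<and> a < b \<longrightarrow>
        distr N (count_space UNIV) (\<lambda>x. Y b x - Y a x) = measure_pmf (poisson_pmf (r * (b - a))))"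

text \<open>
  Species are numbered \<open>1, \<dots>, s\<close>; \<open>\<Lambda> i\<close> is the random rate of species \<open>i\<close> and \<open>Y i t\<close> the
  number of its individuals sampled during \<open>[0, t]\<close>. The rates are discrete, so conditioning on
  them is elementary conditioning on the events \<open>{\<Lambda> = r}\<close> of positive probability.
\<close>

locale species_sampling = prob_space M
  for M :: "'a measure" +
  fixes s :: nat and \<Theta> :: "real measure"
    and \<Lambda> :: "nat \<Rightarrow> 'a \<Rightarrow> real" and Y :: "nat \<Rightarrow> real \<Rightarrow> 'a \<Rightarrow> nat"
  assumes rates_indep: "indep_vars (\<lambda>_. borel) \<Lambda> {1..s}"
    and rates_distr: "\<And>i. i \<in> {1..s} \<Longrightarrow> distr M borel (\<Lambda> i) = \<Theta>"
    and counts_measurable: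
      "\<And>i t. i \<in> {1..s} \<Longrightarrow> 0 \<le> t \<Longrightarrow> Y i t \<in> measurable M (count_space UNIV)"
    and counts_poisson:
      "\<And>r i. prob {x \<in> space M. \<forall>k\<in>{1..s}. \<Lambda> k x = r k} > 0 \<Longrightarrow> i \<in> {1..s} \<Longrightarrow>
         poisson_process (uniform_measure M {x \<in> space M. \<forall>k\<in>{1..s}. \<Lambda> k x = r k}) (r i) (Y i)"

definition species_count :: "nat \<Rightarrow> (nat \<Rightarrow> real \<Rightarrow> 'a \<Rightarrow> nat) \<Rightarrow> nat \<Rightarrow> real \<Rightarrow> 'a \<Rightarrow> real" where
  "species_count s Y j t x = (\<Sum>i=1..s. of_bool (Y i t x = j))"

definition phi :: "'a measure \<Rightarrow> nat \<Rightarrow> (nat \<Rightarrow> real \<Rightarrow> 'a \<Rightarrow> nat) \<Rightarrow> nat \<Rightarrow> real \<Rightarrow> real" where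
  "phi M s Y j t = integral\<^sup>L M (species_count s Y j t)"

definition phi_plus :: "'a measure \<Rightarrow> nat \<Rightarrow> (nat \<Rightarrow> real \<Rightarrow> 'a \<Rightarrow> nat) \<Rightarrow> real \<Rightarrow> real" where
  "phi_plus M s Y t = (\<Sum>j. phi M s Y (Suc j) t)"

definition omega :: "nat \<Rightarrow> (nat \<Rightarrow> real) \<Rightarrow> (nat \<Rightarrow> real) \<Rightarrow> nat \<Rightarrow> real" where
  "omega \<nu> \<pi> \<gamma> u =
     \<pi> u * (1 - exp (- \<gamma> u)) / (\<Sum>w=1..\<nu>. \<pi> w * (1 - exp (- \<gamma> w)))"

text \<open>
  The distribution \<open>Q\<close> enters \<open>\<theta>\<^sub>j(t, Q)\<close> through its number of atoms, weights and atoms;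
  \<open>theta_eq_integral\<close> shows that the value depends on the measure \<open>Q\<close> only.
\<close>

definition theta :: "nat \<Rightarrow> real \<Rightarrow> nat \<Rightarrow> (nat \<Rightarrow> real) \<Rightarrow> (nat \<Rightarrow> real) \<Rightarrow> real" where
  "theta j t \<nu> w g =
     (\<Sum>u=1..\<nu>. w u * (exp (- g u * t) * (g u * t) ^ j / ((1 - exp (- g u)) * fact j)))"

lemma theta_eq_integral:
  assumes "\<And>u. u \<in> {1..\<nu>} \<Longrightarrow> 0 \<le> w u"
  shows "theta j t \<nu> w g =
    (\<integral>x. exp (- x * t) * (x * t) ^ j / ((1 - exp (- x)) * fact j) \<partial>finite_mixture \<nu> w g)"
proof -
  have "(\<integral>x. exp (- x * t) * (x * t) ^ j / ((1 - exp (- x)) * fact j) \<partial>finite_mixture \<nu> w g)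
    = (\<integral>u. exp (- g u * t) * (g u * t) ^ j / ((1 - exp (- g u)) * fact j)
         \<partial>point_measure {1..\<nu>} (\<lambda>u. ennreal (w u)))"
    unfolding finite_mixture_def by (rule integral_distr) auto
  also have "\<dots> = theta j t \<nu> w g"
    unfolding theta_def using assms by (subst lebesgue_integral_point_measure_finite) auto
  finally show ?thesis ..
qed

end

theory Submission
  imports Defs
begin

text \<open>
  Conditioning on the rates turns the probability that a species is represented \<open>j\<close> times into the
  \<open>\<Theta>\<close>-average of a Poisson mass, which gives the formula for \<open>\<phi>\<^sub>j(t)\<close>. Summing it over \<open>j \<ge> 1\<close> at
  \<open>t = 1\<close> shows that \<open>\<phi>\<^sub>+(1)\<close> is \<open>s\<close> times the denominator of \<open>\<omega>\<^sub>u\<close>, so the normalising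
  constants and the factors \<open>1 - exp (- \<gamma>\<^sub>u)\<close> cancel.
\<close>

lemma integral_finite_mixture:
  fixes f :: "real \<Rightarrow> real"
  assumes "\<And>u. u \<in> {1..\<nu>} \<Longrightarrow> 0 \<le> w u" and "f \<in> borel_measurable borel"
  shows "(\<integral>x. f x \<partial>finite_mixture \<nu> w g) = (\<Sum>u=1..\<nu>. w u * f (g u))"
proof -
  have "(\<integral>x. f x \<partial>finite_mixture \<nu> w g)
      = (\<integral>u. f (g u) \<partial>point_measure {1..\<nu>} (\<lambda>u. ennreal (w u)))"
    unfolding finite_mixture_def using assms(2) by (intro integral_distr) auto
  also have "\<dots> = (\<Sum>u=1..\<nu>. w u * f (g u))"
    using assms(1) by (subst lebesgue_integral_point_measure_finite) auto
  finally show ?thesis .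
qed

lemma AE_finite_mixture: "AE x in finite_mixture \<nu> w g. x \<in> g ` {1..\<nu>}"
  unfolding finite_mixture_def
  by (subst AE_distr_iff) (auto simp: AE_point_measure finite_imp_closed)

text \<open>For \<open>t > 0\<close> the count \<open>Y t\<close> agrees almost surely with the
  increment over \<open>[0, t]\<close>, since \<open>Y 0\<close> vanishes almost surely; the
  increment law then gives the Poisson mass. That law covers only nondegenerate intervals, so
  \<open>t = 0\<close> is a separate case.\<close>

lemma poisson_process_measure:
  assumes "poisson_process N r Y" and "0 \<le> t"
  shows "measure N {x \<in> space N. Y t x = j} = exp (- r * t) * (r * t) ^ j / fact j"
proof -
  interpret prob_space N
    using assms(1) by (simp add: poisson_process_def)
  have r: "0 < r" and meas: "\<And>t. 0 \<le> t \<Longrightarrow> Y t \<in> measurable N (count_space UNIV)"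
    and start: "AE x in N. Y 0 x = 0"
    and incr: "\<And>a b. 0 \<le> a \<Longrightarrow> a < b \<Longrightarrow>
      distr N (count_space UNIV) (\<lambda>x. Y b x - Y a x) = measure_pmf (poisson_pmf (r * (b - a)))"
    using assms(1) by (auto simp: poisson_process_def)
  note [measurable] = meas[OF assms(2)] meas[of 0, simplified]
  show ?thesis
  proof (cases "t = 0")
    case True
    have "measure N {x \<in> space N. Y t x = j} = measure N {x \<in> space N. j = 0}"
      by (rule finite_measure_eq_AE) (use start True in auto)
    \<comment> \<open>At \<open>t = 0\<close> the right-hand side is \<open>0 ^ j / fact j\<close>;
      the convention \<open>0 ^ 0 = 1\<close> gives the full mass at \<open>j = 0\<close>.\<close>
    then show ?thesis
      using True by (cases "j = 0") (auto simp: prob_space)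
  next
    case False
    have "measure N {x \<in> space N. Y t x = j} = measure N {x \<in> space N. Y t x - Y 0 x = j}"
      by (rule finite_measure_eq_AE) (use start in auto)
    also have "\<dots> = measure (distr N (count_space UNIV) (\<lambda>x. Y t x - Y 0 x)) {j}"
      by (subst measure_distr) (auto intro!: arg_cong[where f = "measure N"])
    also have "\<dots> = pmf (poisson_pmf (r * t)) j"
      using incr[of 0 t] False assms(2) by (simp add: measure_pmf_single)
    finally show ?thesis
      using r False assms(2) by simp
  qed
qed

text \<open>The exponential series without its zeroth term, scaled by \<open>exp (- r)\<close>: for
  positive \<open>r\<close>, the Poisson mass of the positive counts.\<close>

lemma sums_poisson_positive:
  fixes r :: real
  shows "(\<lambda>j. exp (- r) * r ^ Suc j / fact (Suc j)) sums (1 - exp (- r))"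
proof -
  have "(\<lambda>j. r ^ j / fact j) sums exp r"
    using exp_converges[of r] by (simp add: divide_inverse mult.commute)
  then have "(\<lambda>j. r ^ Suc j / fact (Suc j)) sums (exp r - 1)"
    by (subst sums_Suc_iff) simp
  then have "(\<lambda>j. exp (- r) * (r ^ Suc j / fact (Suc j))) sums (exp (- r) * (exp r - 1))"
    by (rule sums_mult)
  then show ?thesis
    by (simp add: algebra_simps flip: exp_add)
qed

context species_sampling
begin

text \<open>Law of total probability over the finitely many possible rate vectors: given the vector,
  the count of species \<open>i\<close> is Poisson with rate \<open>r i\<close>, and averaging over
  the vectors leaves an integral against the law \<Theta> of \<open>\<Lambda> i\<close>.\<close>

lemma prob_count_eq:
  assumes pos: "\<And>u. u \<in> {1..\<nu>} \<Longrightarrow> 0 < \<pi> u" and \<Theta>: "\<Theta> = finite_mixture \<nu> \<pi> \<gamma>"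
    and i: "i \<in> {1..s}" and t: "0 \<le> t"
  shows "prob {x \<in> space M. Y i t x = j}
    = (\<Sum>u=1..\<nu>. \<pi> u * (exp (- \<gamma> u * t) * (\<gamma> u * t) ^ j / fact j))"
proof -
  define f where "f r = exp (- r * t) * (r * t) ^ j / fact j" for r :: real
  \<comment> \<open>The extensional product makes each rate vector on \<open>{1..s}\<close> a single
    element of \<open>R\<close>, so the events \<open>E r\<close> with \<open>r\<close> in
    \<open>R\<close> are pairwise disjoint.\<close>
  define R where "R = PiE {1..s} (\<lambda>_. \<gamma> ` {1..\<nu>})"
  define E where "E r = {x \<in> space M. \<forall>k\<in>{1..s}. \<Lambda> k x = r k}" for r
  define A where "A = {x \<in> space M. Y i t x = j}"
  have \<Lambda>: "\<Lambda> k \<in> borel_measurable M" if "k \<in> {1..s}" for k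
    using rates_indep that by (auto simp: indep_vars_def)
  have f: "f \<in> borel_measurable borel"
    unfolding f_def by measurable
  have R: "finite R"
    unfolding R_def by (intro finite_PiE) auto
  have A: "A \<in> events"
    unfolding A_def using counts_measurable[OF i t] by measurable
  have E: "E r \<in> events" for r
    unfolding E_def using \<Lambda> by (intro sets.sets_Collect_finite_All) auto
  \<comment> \<open>The product form avoids dividing by \<open>prob (E r)\<close>: for null
    \<open>E r\<close>, where nothing is known about the conditional law, both sides are
    zero.\<close>
  have cond: "prob (A \<inter> E r) = f (r i) * prob (E r)" for r
  proof (cases "prob (E r) > 0")
    case True
    let ?N = "uniform_measure M (E r)"
    have "prob (A \<inter> E r) / prob (E r) = measure ?N A"
      using True A E by (simp add: measure_uniform_measure emeasure_eq_measure Int_commute)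
    also have "\<dots> = f (r i)"
      using poisson_process_measure[OF counts_poisson[OF _ i, of r, folded E_def, OF True] t, of j]
      by (simp add: A_def f_def)
    finally show ?thesis
      using True by (simp add: field_simps)
  next
    case False
    then have "prob (E r) = 0"
      using measure_nonneg[of M "E r"] by linarith
    moreover have "prob (A \<inter> E r) \<le> prob (E r)"
      using E by (intro finite_measure_mono) auto
    ultimately show ?thesis
      using measure_nonneg[of M "A \<inter> E r"] by simp
  qed
  have supp: "AE x in M. \<forall>k\<in>{1..s}. \<Lambda> k x \<in> \<gamma> ` {1..\<nu>}"
  proof (intro AE_finite_allI)
    fix k assume k: "k \<in> {1..s}"
    have "AE y in distr M borel (\<Lambda> k). y \<in> \<gamma> ` {1..\<nu>}"
      unfolding rates_distr[OF k] \<Theta> by (rule AE_finite_mixture)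
    then show "AE x in M. \<Lambda> k x \<in> \<gamma> ` {1..\<nu>}"
      by (rule AE_distrD[OF \<Lambda>[OF k]])
  qed simp
  \<comment> \<open>Exactly one \<open>E r\<close> contains \<open>x\<close>, so the sum collapses
    to one term. This is used twice: with \<open>h\<close> constant, to split \<open>A\<close>, and
    with \<open>h r = f (r i)\<close>, to reassemble \<open>f (\<Lambda> i x)\<close>.\<close>
  have part: "(\<Sum>r\<in>R. h r * indicator (E r) x) = h (restrict (\<lambda>k. \<Lambda> k x) {1..s})"
    if "x \<in> space M" "\<forall>k\<in>{1..s}. \<Lambda> k x \<in> \<gamma> ` {1..\<nu>}" for h :: "(nat \<Rightarrow> real) \<Rightarrow> real" and x
  proof -
    let ?r = "restrict (\<lambda>k. \<Lambda> k x) {1..s}"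
    have r: "?r \<in> R"
      using that(2) by (auto simp: R_def)
    have "x \<in> E r \<longleftrightarrow> r = ?r" if "r \<in> R" for r
      using that \<open>x \<in> space M\<close> unfolding E_def R_def
      by (auto simp: PiE_iff extensional_def restrict_def fun_eq_iff)
    then have "(\<Sum>r\<in>R. h r * indicator (E r) x) = (\<Sum>r\<in>R. if r = ?r then h r else 0)"
      by (intro sum.cong) (auto simp: indicator_def)
    then show ?thesis
      using r R by simp
  qed
  have "prob A = (\<integral>x. indicator A x \<partial>M)"
    using A by simp
  also have "\<dots> = (\<integral>x. (\<Sum>r\<in>R. indicator (A \<inter> E r) x) \<partial>M)"
  proof (rule integral_cong_AE)
    show "AE x in M. indicator A x = (\<Sum>r\<in>R. indicator (A \<inter> E r) x :: real)"
      using supp AE_space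
    proof eventually_elim
      case (elim x)
      then show ?case
        using part[of x "\<lambda>_. indicator A x"] by (simp add: indicator_inter_arith)
    qed
  qed (use A E in measurable)
  also have "\<dots> = (\<Sum>r\<in>R. prob (A \<inter> E r))"
    using A E by (subst Bochner_Integration.integral_sum) (auto simp: emeasure_eq_measure)
  also have "\<dots> = (\<Sum>r\<in>R. f (r i) * prob (E r))"
    by (simp add: cond)
  \<comment> \<open>The joint probabilities \<open>prob (E r)\<close> need not be computed: read as
    an integral, the sum depends on the rate of species \<open>i\<close> alone.\<close>
  also have "\<dots> = (\<integral>x. (\<Sum>r\<in>R. f (r i) * indicator (E r) x) \<partial>M)"
    using E by (subst Bochner_Integration.integral_sum) (auto simp: emeasure_eq_measure)
  also have "\<dots> = (\<integral>x. f (\<Lambda> i x) \<partial>M)"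
  proof (rule integral_cong_AE)
    show "AE x in M. (\<Sum>r\<in>R. f (r i) * indicator (E r) x) = f (\<Lambda> i x)"
      using supp AE_space
    proof eventually_elim
      case (elim x)
      then show ?case
        using part[of x "\<lambda>r. f (r i)"] i by simp
    qed
  qed (use E f \<Lambda>[OF i] in measurable)
  also have "\<dots> = (\<integral>y. f y \<partial>finite_mixture \<nu> \<pi> \<gamma>)"
    using integral_distr[OF \<Lambda>[OF i] f] rates_distr[OF i] \<Theta> by simp
  also have "\<dots> = (\<Sum>u=1..\<nu>. \<pi> u * f (\<gamma> u))"
    using pos f by (intro integral_finite_mixture) (auto intro: less_imp_le)
  finally show ?thesis
    by (simp add: A_def f_def)
qed

text \<open>By linearity of expectation; the \<open>s\<close> species contribute equally because
  their rates share the law \<Theta>.\<close>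

lemma phi_eq:
  assumes "\<And>u. u \<in> {1..\<nu>} \<Longrightarrow> 0 < \<pi> u" and "\<Theta> = finite_mixture \<nu> \<pi> \<gamma>" and t: "0 \<le> t"
  shows "phi M s Y j t
    = real s * (\<Sum>u=1..\<nu>. \<pi> u * (exp (- \<gamma> u * t) * (\<gamma> u * t) ^ j / fact j))"
proof -
  have ev: "{x \<in> space M. Y i t x = j} \<in> events" if "i \<in> {1..s}" for i
    using counts_measurable[OF that t] by measurable
  have "phi M s Y j t = (\<integral>x. (\<Sum>i=1..s. indicator {x \<in> space M. Y i t x = j} x) \<partial>M)"
    unfolding phi_def species_count_def
    by (intro Bochner_Integration.integral_cong sum.cong) (auto simp: indicator_def)
  also have "\<dots> = (\<Sum>i=1..s. prob {x \<in> space M. Y i t x = j})"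
    using ev by (subst Bochner_Integration.integral_sum) (auto simp: emeasure_eq_measure)
  finally show ?thesis
    using prob_count_eq[OF assms(1,2) _ t] by simp
qed

text \<open>The series over \<open>j\<close> is taken inside the finite sum over the atoms, where it
  is the Poisson series at rate \<open>\<gamma> u\<close>.\<close>

lemma phi_plus_one_eq:
  assumes "\<And>u. u \<in> {1..\<nu>} \<Longrightarrow> 0 < \<pi> u" and "\<Theta> = finite_mixture \<nu> \<pi> \<gamma>"
  shows "phi_plus M s Y 1 = real s * (\<Sum>u=1..\<nu>. \<pi> u * (1 - exp (- \<gamma> u)))"
proof -
  have "(\<lambda>j. real s * (\<Sum>u=1..\<nu>. \<pi> u * (exp (- \<gamma> u) * \<gamma> u ^ Suc j / fact (Suc j))))
      sums (real s * (\<Sum>u=1..\<nu>. \<pi> u * (1 - exp (- \<gamma> u))))"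
    by (intro sums_mult sums_sum sums_poisson_positive)
  then have "(\<lambda>j. phi M s Y (Suc j) 1) sums (real s * (\<Sum>u=1..\<nu>. \<pi> u * (1 - exp (- \<gamma> u))))"
    using phi_eq[OF assms, of 1] by simp
  then show ?thesis
    unfolding phi_plus_def by (rule sums_unique[symmetric])
qed

end

theorem proposition1:
  fixes M :: "'a measure" and s \<nu> h j :: nat and \<pi> \<gamma> :: "nat \<Rightarrow> real" and t :: real
    and \<Lambda> :: "nat \<Rightarrow> 'a \<Rightarrow> real" and Y :: "nat \<Rightarrow> real \<Rightarrow> 'a \<Rightarrow> nat"
  assumes "s \<ge> 1"
    and "\<And>u. u \<in> {1..\<nu>} \<Longrightarrow> \<pi> u > 0"
    and "(\<Sum>u=1..\<nu>. \<pi> u) = 1"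
    and "inj_on \<gamma> {1..\<nu>}"
    and "\<And>u. u \<in> {1..\<nu>} \<Longrightarrow> \<gamma> u > 0"
    and "species_sampling M s (finite_mixture \<nu> \<pi> \<gamma>) \<Lambda> Y"
    and "h \<ge> 1" and "j \<in> {1..h}" and "t \<ge> 0"
  shows "phi M s Y j t = phi_plus M s Y 1 * theta j t \<nu> (omega \<nu> \<pi> \<gamma>) \<gamma>"
proof -
  interpret species_sampling M s "finite_mixture \<nu> \<pi> \<gamma>" \<Lambda> Y
    by fact
  define D where "D = (\<Sum>w=1..\<nu>. \<pi> w * (1 - exp (- \<gamma> w)))"
  \<comment> \<open>Weights with sum 1 force at least one atom, so the normalising constant
    \<open>D\<close> is a nonempty sum of positive terms.\<close>
  have "{1..\<nu>} \<noteq> {}"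
    using assms(3) by (metis sum.empty zero_neq_one)
  then have D: "D > 0"
    unfolding D_def using assms(2,5) by (intro sum_pos) auto
  \<comment> \<open>Termwise, \<open>D\<close> cancels the denominator of \<open>omega\<close>, and
    \<open>1 - exp (- \<gamma> u)\<close>, nonzero as \<open>\<gamma> u > 0\<close>, cancels between
    \<open>omega\<close> and \<open>theta\<close>.\<close>
  have "D * theta j t \<nu> (omega \<nu> \<pi> \<gamma>) \<gamma>
      = (\<Sum>u=1..\<nu>. \<pi> u * (exp (- \<gamma> u * t) * (\<gamma> u * t) ^ j / fact j))"
    unfolding theta_def sum_distrib_left
  proof (rule sum.cong)
    fix u assume "u \<in> {1..\<nu>}"
    then have "1 - exp (- \<gamma> u) \<noteq> 0"
      using assms(5)[of u] by simp
    with D show "D * (omega \<nu> \<pi> \<gamma> u *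
          (exp (- \<gamma> u * t) * (\<gamma> u * t) ^ j / ((1 - exp (- \<gamma> u)) * fact j)))
        = \<pi> u * (exp (- \<gamma> u * t) * (\<gamma> u * t) ^ j / fact j)"
      unfolding omega_def D_def[symmetric] by (simp add: divide_simps)
  qed simp
  then show ?thesis
    using phi_eq[OF assms(2) refl \<open>t \<ge> 0\<close>] phi_plus_one_eq[OF assms(2) refl]
    by (simp add: D_def mult.assoc)
qed

end
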